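(* Let $n\ge2$, let $\Delta_k\in\mathcal S^k(\mathfrak{gl}_n)^{\mathfrak{gl}_n}$ be the coefficients of the characteristic polynomial, and let $\tilde\Delta_k\in\mathcal S^k(\mathfrak{sl}_n)^{\mathfrak{sl}_n}$ be the restriction of $\Delta_k$ to $\mathfrak{sl}_n$ ($k\le n$). Then $$\mathsf m_{2r+1}(\tilde\Delta_k)=\frac{(2r)!\,(k-2r)!}{k!}\binom{n-k+2r}{2r}\,\tilde\Delta_{k-2r}$$ if $k-2r>1$, and $\mathsf m(\tilde\Delta_3)=\mathsf m(\Delta_3)=0$.
   Context: For $\xi\in(\mathfrak{gl}_n)^*\cong\mathfrak{gl}_n$, $\det(qI_n-\xi)=q^n-\Delta_1(\xi)q^{n-1}+\dots+(-1)^k\Delta_k(\xi)q^{n-k}+\dots+(-1)^n\Delta_n(\xi)$; in other words $\Delta_k$ is the sum of the principal $k\times k$ minors of the matrix $(E_{ij})$. The restriction of $H\in\mathcal S(\mathfrak{gl}_n)$ to $\mathfrak{sl}_n$ is the image of $H$ under $\mathcal S(\mathfrak{gl}_n)\to\mathcal S(\mathfrak{gl}_n)/(I_n)\cong\mathcal S(\mathfrak{sl}_n)$ (using $\mathfrak{gl}_n=\mathfrak{sl}_n\oplus\mathbb CI_n$). Maps $\mathsf m_{2r+1}$: for a reductive Lie algebra $\mathfrak g$, embed $\mathcal S^k(\mathfrak g)$ in $\mathfrak g^{\otimes k}$ via the symmetrisation $\varpi(y_1\cdots y_k)=\frac1{k!}\sum_{\sigma\in S_k}y_{\sigma(1)}\otimes\dots\otimes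 y_{\sigma(k)}$. For $2r+1\le k$, $\mathsf m_{2r+1}$ is the restriction to $\mathcal S^k(\mathfrak g)$ of the map $\mathfrak g^{\otimes k}\to\mathfrak{gl}(\mathfrak g)\otimes\mathfrak g^{\otimes(k-2r-1)}$, $y_1\otimes\dots\otimes y_k\mapsto\operatorname{ad}(y_1)\cdots\operatorname{ad}(y_{2r+1})\otimes y_{2r+2}\otimes\dots\otimes y_k$; the image lies in $\mathfrak{so}(\mathfrak g)\otimes\mathfrak g^{\otimes(k-2r-1)}\cong\Lambda^2\mathfrak g\otimes\mathfrak g^{\otimes(k-2r-1)}$. Put $\mathsf m=\mathsf m_3$. For $\mathfrak g=\mathfrak{sl}_n$ one regards $\mathfrak g\subset\mathfrak{so}(\mathfrak g)$ via $\operatorname{ad}$, and $\mathcal S^{k-2r}(\mathfrak g)\subset\mathfrak g^{\otimes(k-2r)}=\mathfrak g\otimes\mathfrak g^{\otimes(k-2r-1)}\subset\mathfrak{so}(\mathfrak g)\otimes\mathfrak g^{\otimes(k-2r-1)}$ via $\varpi$; the displayed equality is understood in this sense. *)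

theory Defs
  imports "HOL-Analysis.Analysis" "HOL-Library.Poly_Mapping"
begin

text \<open>
  Throughout, \<open>gl\<^sub>n\<close> is \<open>complex ^ 'n ^ 'n\<close> with \<open>n = CARD('n)\<close>, and \<open>E\<^sub>i\<^sub>j\<close> is its standard basis,
  indexed by \<open>(i, j) :: 'n \<times> 'n\<close>.

  \<^item> The symmetric algebra \<open>S(gl\<^sub>n)\<close> is the polynomial ring in the \<open>E\<^sub>i\<^sub>j\<close>; a monomial
    \<open>E\<^bsub>u1\<^esub> \<cdots> E\<^bsub>uk\<^esub>\<close> is the multiset of its indices.
  \<^item> An element of \<open>gl\<^sub>n\<^sup>\<otimes>\<^sup>k\<close> is the family of its coefficients with respect to the basis
    \<open>E\<^bsub>u1\<^esub> \<otimes> \<dots> \<otimes> E\<^bsub>uk\<^esub>\<close>, indexed by the words \<open>[u1, \<dots>, uk]\<close> (it is zero on words of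
    any other length).
  \<^item> An element of \<open>gl(g) \<otimes> gl\<^sub>n\<^sup>\<otimes>\<^sup>j\<close> is likewise a family, indexed by words of length \<open>j\<close>,
    of linear endomorphisms of \<open>g\<close>.

  For \<open>g = sl\<^sub>n\<close> the spaces \<open>S(g)\<close>, \<open>g\<^sup>\<otimes>\<^sup>k\<close> and \<open>gl(g) \<otimes> g\<^sup>\<otimes>\<^sup>j\<close> are used as subspaces of the above.
\<close>

type_synonym 'n gl = "complex ^ 'n ^ 'n"
type_synonym 'n sym_gl = "('n \<times> 'n) multiset \<Rightarrow>\<^sub>0 complex"
type_synonym 'n tensor = "('n \<times> 'n) list \<Rightarrow> complex"
type_synonym 'n end_tensor = "('n \<times> 'n) list \<Rightarrow> 'n gl \<Rightarrow> 'n gl"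


section \<open>The Lie algebras\<close>

definition msc :: "complex \<Rightarrow> 'n::finite gl \<Rightarrow> 'n gl" where
  "msc c A = (\<chi> i j. c * A $ i $ j)"

definition munit :: "'n \<times> 'n \<Rightarrow> 'n::finite gl" where
  "munit u = axis (fst u) (axis (snd u) 1)"

definition gl :: "'n::finite gl set" where
  "gl = UNIV"

definition sl :: "'n::finite gl set" where
  "sl = {A. trace A = 0}"

definition ad :: "'n::finite gl \<Rightarrow> 'n gl \<Rightarrow> 'n gl" where
  "ad y X = y ** X - X ** y"

text \<open>\<open>ad_prod [y1, \<dots>, ym] = ad(y1) \<circ> \<dots> \<circ> ad(ym)\<close>\<close>

definition ad_prod :: "'n::finite gl list \<Rightarrow> 'n gl \<Rightarrow> 'n gl" where
  "ad_prod ys = foldr (\<lambda>y f. ad y \<circ> f) ys id"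


section \<open>Symmetric algebras, the coefficients of the characteristic polynomial\<close>

definition const :: "complex \<Rightarrow> 'n sym_gl" where
  "const c = Poly_Mapping.single {#} c"

definition gen :: "'n \<times> 'n \<Rightarrow> 'n sym_gl" where
  "gen u = Poly_Mapping.single {#u#} 1"

text \<open>The inclusion of \<open>gl\<^sub>n\<close> into \<open>S(gl\<^sub>n)\<close> as the linear forms\<close>

definition lin :: "'n::finite gl \<Rightarrow> 'n sym_gl" where
  "lin y = (\<Sum>u\<in>UNIV. const (y $ fst u $ snd u) * gen u)"

text \<open>\<open>det(q I - \<xi>)\<close> for the generic matrix \<open>\<xi> = (E\<^sub>i\<^sub>j)\<close>, as a polynomial in \<open>q\<close> over \<open>S(gl\<^sub>n)\<close>\<close>

definition generic_charpoly :: "'n::finite sym_gl poly" where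
  "generic_charpoly = det (mat [:0, 1:] - (\<chi> i j. [:gen (i, j):]) :: 'n sym_gl poly ^ 'n ^ 'n)"

text \<open>The case distinction keeps the truncated subtraction from producing junk for \<open>k > n\<close>; zero is
  the (empty) sum of principal minors there.\<close>

definition Delta :: "nat \<Rightarrow> 'n::finite sym_gl" where
  "Delta k = (if k \<le> CARD('n) then (-1) ^ k * coeff generic_charpoly (CARD('n) - k) else 0)"

text \<open>\<open>S(sl\<^sub>n)\<close>: the subalgebra of \<open>S(gl\<^sub>n)\<close> generated by \<open>sl\<^sub>n\<close>\<close>

inductive_set sym_sl :: "'n::finite sym_gl set" where
  const: "const c \<in> sym_sl"
| lin: "y \<in> sl \<Longrightarrow> lin y \<in> sym_sl"
| add: "f \<in> sym_sl \<Longrightarrow> g \<in> sym_sl \<Longrightarrow> f + g \<in> sym_sl"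
| mult: "f \<in> sym_sl \<Longrightarrow> g \<in> sym_sl \<Longrightarrow> f * g \<in> sym_sl"

text \<open>The image under \<open>S(gl\<^sub>n) \<rightarrow> S(gl\<^sub>n)/(I\<^sub>n) \<cong> S(sl\<^sub>n)\<close>: the representative in \<open>S(sl\<^sub>n)\<close> of the class
  modulo the principal ideal \<open>(I\<^sub>n)\<close>. It is unique by \<open>sl_restriction_ex1\<close> below.\<close>

definition sl_restriction :: "'n::finite sym_gl \<Rightarrow> 'n sym_gl" where
  "sl_restriction H = (THE H'. H' \<in> sym_sl \<and> lin (mat 1) dvd H - H')"

definition Delta_sl :: "nat \<Rightarrow> 'n::finite sym_gl" where
  "Delta_sl k = sl_restriction (Delta k)"


section \<open>Symmetrisation and the maps \<open>m\<close>\<close>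

text \<open>\<open>y1 \<otimes> \<dots> \<otimes> yk\<close>\<close>

definition pure :: "'n::finite gl list \<Rightarrow> 'n tensor" where
  "pure ys w = (if length w = length ys
     then \<Prod>a<length ys. ys ! a $ fst (w ! a) $ snd (w ! a) else 0)"

definition sym_pure :: "'n::finite gl list \<Rightarrow> 'n tensor" where
  "sym_pure ys w = (1 / fact (length ys)) *
     (\<Sum>\<sigma> | \<sigma> permutes {..<length ys}. pure (permute_list \<sigma> ys) w)"

text \<open>The embedding of \<open>S\<^sup>k(gl\<^sub>n)\<close> into \<open>gl\<^sub>n\<^sup>\<otimes>\<^sup>k\<close>, defined on monomials and extended linearly. The order in
  which the factors of a monomial are listed is irrelevant; for products of arbitrary elements of
  \<open>gl\<^sub>n\<close> see \<open>symmetrise_prod_lin\<close>. On \<open>S(sl\<^sub>n)\<close> this is the symmetrisation of \<open>sl\<^sub>n\<close>.\<close>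

definition symmetrise :: "'n::finite sym_gl \<Rightarrow> 'n tensor" where
  "symmetrise H w = (\<Sum>M\<in>Poly_Mapping.keys H. Poly_Mapping.lookup H M *
     sym_pure (map munit (SOME us. mset us = M)) w)"

text \<open>The linear map \<open>y1 \<otimes> \<dots> \<otimes> yk \<mapsto> ad(y1) \<cdots> ad(ym) \<otimes> y(m+1) \<otimes> \<dots> \<otimes> yk\<close>, see \<open>ad_tensor_pure\<close>\<close>

definition ad_tensor :: "nat \<Rightarrow> 'n::finite tensor \<Rightarrow> 'n end_tensor" where
  "ad_tensor m t w X = (\<Sum>v | length v = m. msc (t (v @ w)) (ad_prod (map munit v) X))"

text \<open>Restriction of endomorphisms of \<open>gl\<^sub>n\<close> to \<open>g\<close>; they are set to zero off \<open>g\<close>, so that equality of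
  families is equality of endomorphisms of \<open>g\<close>.\<close>

definition restrict_to :: "'n::finite gl set \<Rightarrow> 'n end_tensor \<Rightarrow> 'n end_tensor" where
  "restrict_to g F = (\<lambda>w X. if X \<in> g then F w X else 0)"

definition scale_end :: "complex \<Rightarrow> 'n::finite end_tensor \<Rightarrow> 'n end_tensor" where
  "scale_end c F = (\<lambda>w X. msc c (F w X))"

text \<open>For \<open>g = gl\<^sub>n\<close> or \<open>g = sl\<^sub>n\<close>: the map \<open>m\<close> with \<open>m\<close> adjoint factors, on \<open>S(g)\<close>\<close>

definition m_map :: "'n::finite gl set \<Rightarrow> nat \<Rightarrow> 'n sym_gl \<Rightarrow> 'n end_tensor" where
  "m_map g m H = restrict_to g (ad_tensor m (symmetrise H))"

text \<open>\<open>S\<^sup>k(g) \<subset> g\<^sup>\<otimes>\<^sup>k = g \<otimes> g\<^sup>\<otimes>\<^sup>(\<^sup>k\<^sup>-\<^sup>1\<^sup>) \<subset> gl(g) \<otimes> g\<^sup>\<otimes>\<^sup>(\<^sup>k\<^sup>-\<^sup>1\<^sup>)\<close>, with \<open>g\<close> embedded via \<open>ad\<close>\<close>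

definition ad_embed :: "'n::finite gl set \<Rightarrow> 'n sym_gl \<Rightarrow> 'n end_tensor" where
  "ad_embed g H = restrict_to g
     (\<lambda>w X. \<Sum>u\<in>UNIV. msc (symmetrise H (u # w)) (ad (munit u) X))"


section \<open>Consistency of the definitions\<close>

lemma msc_simps:
  "msc 0 A = 0" "msc c 0 = 0" "msc 1 A = A" "msc c (msc d A) = msc (c * d) A"
  "msc c (A + B) = msc c A + msc c B" "msc (c + d) A = msc c A + msc d A"
  by (simp_all add: msc_def vec_eq_iff algebra_simps)

lemma msc_sum: "msc c (\<Sum>i\<in>I. f i) = (\<Sum>i\<in>I. msc c (f i))"
  by (induction I rule: infinite_finite_induct) (simp_all add: msc_simps)

lemma munit_nth: "munit u $ i $ j = (if i = fst u \<and> j = snd u then 1 else 0)"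
  by (simp add: munit_def axis_def)

lemma gl_decomp: "(\<Sum>u\<in>UNIV. msc (y $ fst u $ snd u) (munit u)) = y"
proof -
  have "(\<Sum>u\<in>UNIV. y $ fst u $ snd u * (munit u $ i $ j)) = y $ i $ j" for i j
  proof -
    have "(\<Sum>u\<in>UNIV. y $ fst u $ snd u * (munit u $ i $ j))
        = (\<Sum>u\<in>UNIV. if u = (i, j) then y $ i $ j else 0)"
      by (intro sum.cong refl) (auto simp: munit_nth)
    then show ?thesis by simp
  qed
  then show ?thesis by (simp add: vec_eq_iff msc_def)
qed

lemma ad_add: "ad (y + z) X = ad y X + ad z X"
  by (simp add: ad_def vec_eq_iff matrix_matrix_mult_def sum.distrib algebra_simps)

lemma ad_msc: "ad (msc c y) X = msc c (ad y X)" "ad y (msc c X) = msc c (ad y X)"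
  by (simp_all add: ad_def msc_def vec_eq_iff matrix_matrix_mult_def sum_distrib_left
      algebra_simps)

lemma ad_add_right: "ad y (X + Z) = ad y X + ad y Z"
  by (simp add: ad_def vec_eq_iff matrix_matrix_mult_def sum.distrib algebra_simps)

lemma ad_zero: "ad 0 X = 0" "ad y 0 = 0"
  by (simp_all add: ad_def matrix_matrix_mult_def vec_eq_iff)

lemma ad_sum: "ad (\<Sum>i\<in>I. f i) X = (\<Sum>i\<in>I. ad (f i) X)"
  by (induction I rule: infinite_finite_induct) (simp_all add: ad_zero ad_add)

lemma ad_sum_right: "ad y (\<Sum>i\<in>I. f i) = (\<Sum>i\<in>I. ad y (f i))"
  by (induction I rule: infinite_finite_induct) (simp_all add: ad_zero ad_add_right)

lemma ad_prod_simps: "ad_prod [] X = X" "ad_prod (y # ys) X = ad y (ad_prod ys X)"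
  by (simp_all add: ad_prod_def)

lemma sum_lists_Suc:
  fixes f :: "'a::finite list \<Rightarrow> 'b::comm_monoid_add"
  shows "(\<Sum>v | length v = Suc m. f v) = (\<Sum>u\<in>UNIV. \<Sum>v | length v = m. f (u # v))"
proof -
  have "(\<Sum>u\<in>UNIV. \<Sum>v | length v = m. f (u # v))
      = (\<Sum>p\<in>UNIV \<times> {v. length v = m}. f (fst p # snd p))"
    by (simp add: sum.cartesian_product split_def)
  also have "\<dots> = (\<Sum>v | length v = Suc m. f v)"
    by (rule sum.reindex_bij_witness[of _ "\<lambda>v. (hd v, tl v)" "\<lambda>p. fst p # snd p"])
       (auto simp: length_Suc_conv)
  finally show ?thesis by simp
qed

lemma pure_Cons: "pure (y # ys) (u # w) = y $ fst u $ snd u * pure ys w"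
  by (simp add: pure_def prod.lessThan_Suc_shift del: prod.lessThan_Suc)

lemma ad_tensor_pure:
  "ad_tensor (length ys) (pure (ys @ zs)) w X = msc (pure zs w) (ad_prod ys X)"
proof (induction ys)
  case Nil
  show ?case by (simp add: ad_tensor_def)
next
  case (Cons y ys)
  have "ad_tensor (length (y # ys)) (pure ((y # ys) @ zs)) w X
      = (\<Sum>u\<in>UNIV. msc (y $ fst u $ snd u)
          (ad (munit u) (ad_tensor (length ys) (pure (ys @ zs)) w X)))"
    by (simp add: ad_tensor_def sum_lists_Suc pure_Cons ad_prod_simps ad_sum_right msc_sum
        ad_msc msc_simps)
  also have "\<dots> = ad (\<Sum>u\<in>UNIV. msc (y $ fst u $ snd u) (munit u))
      (ad_tensor (length ys) (pure (ys @ zs)) w X)"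
    by (simp add: ad_sum ad_msc)
  finally show ?case
    by (simp add: gl_decomp Cons.IH ad_msc ad_prod_simps)
qed

lemma sym_pure_mset:
  assumes "mset us = mset vs"
  shows "sym_pure (map munit us) w = sym_pure (map munit vs) w"
proof -
  obtain p where p: "p permutes {..<length vs}" "permute_list p vs = us"
    using mset_eq_permutation[OF assms] by metis
  have len: "length us = length vs" using assms mset_eq_length by blast
  have "(\<Sum>\<sigma> | \<sigma> permutes {..<length vs}. pure (permute_list \<sigma> (map munit us)) w)
      = (\<Sum>\<sigma> | \<sigma> permutes {..<length vs}. pure (permute_list (p \<circ> \<sigma>) (map munit vs)) w)"
  proof (intro sum.cong refl)
    fix \<sigma> assume s: "\<sigma> \<in> {\<sigma>. \<sigma> permutes {..<length vs}}"
    have "permute_list (p \<circ> \<sigma>) (map munit vs) = permute_list \<sigma> (permute_list p (map munit vs))"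
      by (rule permute_list_compose) (use s in simp)
    also have "permute_list p (map munit vs) = map munit us"
      using p by (simp add: permute_list_map)
    finally show "pure (permute_list \<sigma> (map munit us)) w
      = pure (permute_list (p \<circ> \<sigma>) (map munit vs)) w" by (simp only:)
  qed
  also have "\<dots> = (\<Sum>\<sigma> | \<sigma> permutes {..<length vs}. pure (permute_list \<sigma> (map munit vs)) w)"
    using setum_permutations_compose_left[OF p(1), of "\<lambda>\<sigma>. pure (permute_list \<sigma> (map munit vs)) w"]
    by (simp add: o_def)
  finally show ?thesis by (simp add: sym_pure_def len)
qed

lemma symmetrise_superset:
  assumes "finite A" "Poly_Mapping.keys H \<subseteq> A"
  shows "symmetrise H w = (\<Sum>M\<in>A. Poly_Mapping.lookup H M *
     sym_pure (map munit (SOME us. mset us = M)) w)"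
  unfolding symmetrise_def
  by (intro sum.mono_neutral_left) (use assms in \<open>auto simp: in_keys_iff\<close>)

lemma symmetrise_add: "symmetrise (H + K) w = symmetrise H w + symmetrise K w"
proof -
  let ?A = "Poly_Mapping.keys H \<union> Poly_Mapping.keys K"
  have "Poly_Mapping.keys (H + K) \<subseteq> ?A" by (rule Poly_Mapping.keys_add)
  then show ?thesis
    using symmetrise_superset[of ?A "H + K" w] symmetrise_superset[of ?A H w]
      symmetrise_superset[of ?A K w]
    by (simp add: lookup_add algebra_simps sum.distrib)
qed

lemma symmetrise_zero: "symmetrise 0 w = 0"
  by (simp add: symmetrise_def)

lemma symmetrise_sum: "symmetrise (\<Sum>i\<in>I. f i) w = (\<Sum>i\<in>I. symmetrise (f i) w)"
  by (induction I rule: infinite_finite_induct) (simp_all add: symmetrise_zero symmetrise_add)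

lemma symmetrise_single:
  "symmetrise (Poly_Mapping.single (mset us) c) w = c * sym_pure (map munit us) w"
proof -
  have "mset (SOME vs. mset vs = mset us) = mset us" by (rule someI) simp
  from sym_pure_mset[OF this] show ?thesis by (simp add: symmetrise_def)
qed

lemma const_mult: "const c * Poly_Mapping.single M d = Poly_Mapping.single M (c * d)"
  by (simp add: const_def mult_single)

lemma prod_lin:
  "prod_list (map lin ys) = (\<Sum>us | length us = length ys.
     Poly_Mapping.single (mset us) (pure ys us))"
proof (induction ys)
  case Nil
  show ?case by (simp add: pure_def)
next
  case (Cons y ys)
  have "lin y = (\<Sum>u\<in>UNIV. Poly_Mapping.single {#u#} (y $ fst u $ snd u))"
    by (simp add: lin_def gen_def const_mult)
  then show ?case
    by (simp add: Cons.IH sum_lists_Suc pure_Cons sum_product mult_single)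
qed

lemma symmetrise_prod_lin: "symmetrise (prod_list (map lin ys)) w = sym_pure ys w"
proof (cases "length w = length ys")
  case False
  then show ?thesis
    by (auto simp: prod_lin symmetrise_sum symmetrise_single sym_pure_def pure_def intro!: sum.neutral)
next
  case True
  let ?k = "length ys"
  have fin: "finite {us :: ('a \<times> 'a) list. length us = ?k}"
    using finite_lists_length_eq[of "UNIV :: ('a \<times> 'a) set" ?k] by simp
  have key: "(\<Sum>us | length us = ?k. pure ys us * pure (permute_list \<sigma> (map munit us)) w)
      = pure (permute_list \<sigma> ys) w" if s: "\<sigma> permutes {..<?k}" for \<sigma>
  proof -
    let ?i = "inv \<sigma>"
    let ?v = "permute_list ?i w"
    have i: "?i permutes {..<?k}" using s by (rule permutes_inv)
    have 1: "pure (permute_list \<sigma> (map munit us)) w = (if us = ?v then 1 else 0)"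
      if l: "length us = ?k" for us
    proof -
      have "pure (permute_list \<sigma> (map munit us)) w
          = (\<Prod>a<?k. munit (us ! \<sigma> a) $ fst (w ! a) $ snd (w ! a))"
        using l True s permutes_in_image[OF s]
        by (auto simp: pure_def permute_list_nth intro!: prod.cong)
      also have "\<dots> = (\<Prod>a<?k. if us ! \<sigma> a = w ! a then 1 else 0)"
        by (intro prod.cong refl) (auto simp: munit_nth prod_eq_iff)
      also have "\<dots> = (if \<forall>a<?k. us ! \<sigma> a = w ! a then 1 else 0)"
        by (auto intro!: prod.neutral)
      also have "(\<forall>a<?k. us ! \<sigma> a = w ! a) \<longleftrightarrow> us = ?v"
      proof -
        have "us = ?v \<longleftrightarrow> permute_list \<sigma> us = w"
        proof
          assume "us = ?v"
          then have "permute_list \<sigma> us = permute_list (?i \<circ> \<sigma>) w"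
            using permute_list_compose[of \<sigma> w ?i] s True by simp
          then show "permute_list \<sigma> us = w" by (simp add: permutes_inv_o[OF s])
        next
          assume "permute_list \<sigma> us = w"
          then have "?v = permute_list (\<sigma> \<circ> ?i) us"
            using permute_list_compose[of ?i us \<sigma>] i l by simp
          then show "us = ?v" by (simp add: permutes_inv_o[OF s])
        qed
        also have "\<dots> \<longleftrightarrow> (\<forall>a<?k. us ! \<sigma> a = w ! a)"
          using l True s by (auto simp: list_eq_iff_nth_eq permute_list_nth)
        finally show ?thesis by simp
      qed
      finally show ?thesis .
    qed
    have "(\<Sum>us | length us = ?k. pure ys us * pure (permute_list \<sigma> (map munit us)) w)
        = (\<Sum>us | length us = ?k. if us = ?v then pure ys us else 0)"
      by (intro sum.cong refl) (simp add: 1)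
    also have "\<dots> = pure ys ?v"
      using fin True by simp
    also have "\<dots> = (\<Prod>a<?k. ys ! a $ fst (w ! ?i a) $ snd (w ! ?i a))"
      using True i by (auto simp: pure_def permute_list_nth intro!: prod.cong)
    also have "\<dots> = (\<Prod>a<?k. ys ! \<sigma> a $ fst (w ! a) $ snd (w ! a))"
      using prod.permute[OF s, of "\<lambda>a. ys ! a $ fst (w ! ?i a) $ snd (w ! ?i a)"]
      by (simp add: o_def permutes_inverses[OF s])
    also have "\<dots> = pure (permute_list \<sigma> ys) w"
      using True s by (auto simp: pure_def permute_list_nth intro!: prod.cong)
    finally show ?thesis .
  qed
  have "symmetrise (prod_list (map lin ys)) w
      = (\<Sum>us | length us = ?k. pure ys us * sym_pure (map munit us) w)"
    by (simp add: prod_lin symmetrise_sum symmetrise_single)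
  also have "\<dots> = (\<Sum>us | length us = ?k. \<Sum>\<sigma> | \<sigma> permutes {..<?k}.
      1 / fact ?k * (pure ys us * pure (permute_list \<sigma> (map munit us)) w))"
    by (intro sum.cong refl) (simp add: sym_pure_def sum_distrib_left algebra_simps)
  also have "\<dots> = (\<Sum>\<sigma> | \<sigma> permutes {..<?k}. 1 / fact ?k *
      (\<Sum>us | length us = ?k. pure ys us * pure (permute_list \<sigma> (map munit us)) w))"
    by (subst sum.swap) (simp add: sum_distrib_left)
  also have "\<dots> = sym_pure ys w"
    by (simp add: key sym_pure_def sum_distrib_left)
  finally show ?thesis .
qed

text \<open>The algebra endomorphism of \<open>S(gl\<^sub>n)\<close> induced by the projection to \<open>sl\<^sub>n\<close> along \<open>I\<^sub>n\<close>\<close>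

definition sl_part :: "'n::finite gl \<Rightarrow> 'n gl" where
  "sl_part y = y - msc (trace y / of_nat CARD('n)) (mat 1)"

definition sl_subst :: "'n::finite sym_gl \<Rightarrow> 'n sym_gl" where
  "sl_subst H = (\<Sum>M\<in>Poly_Mapping.keys H. const (Poly_Mapping.lookup H M) *
     (\<Prod>u\<in>#M. lin (sl_part (munit u))))"

lemma const_simps:
  "const 0 = 0" "const 1 = 1" "const (c + d) = const c + const d" "const (c * d) = const c * const d"
  "const (c - d) = const c - const d"
  by (simp_all add: const_def mult_single single_add single_diff flip: single_one)

lemma sl_subst_superset:
  assumes "finite A" "Poly_Mapping.keys H \<subseteq> A"
  shows "sl_subst H = (\<Sum>M\<in>A. const (Poly_Mapping.lookup H M) *
     (\<Prod>u\<in>#M. lin (sl_part (munit u))))"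
  unfolding sl_subst_def
  by (intro sum.mono_neutral_left) (use assms in \<open>auto simp: in_keys_iff const_simps\<close>)

lemma sl_subst_add: "sl_subst (H + K) = sl_subst H + sl_subst K"
proof -
  let ?A = "Poly_Mapping.keys H \<union> Poly_Mapping.keys K"
  have "Poly_Mapping.keys (H + K) \<subseteq> ?A" by (rule Poly_Mapping.keys_add)
  then show ?thesis
    using sl_subst_superset[of ?A "H + K"] sl_subst_superset[of ?A H] sl_subst_superset[of ?A K]
    by (simp add: lookup_add algebra_simps sum.distrib const_simps)
qed

lemma sl_subst_zero: "sl_subst 0 = 0"
  by (simp add: sl_subst_def)

lemma sl_subst_sum: "sl_subst (\<Sum>i\<in>I. f i) = (\<Sum>i\<in>I. sl_subst (f i))"
  by (induction I rule: infinite_finite_induct) (simp_all add: sl_subst_zero sl_subst_add)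

lemma sl_subst_single:
  "sl_subst (Poly_Mapping.single M c) = const c * (\<Prod>u\<in>#M. lin (sl_part (munit u)))"
  by (simp add: sl_subst_def const_simps)

lemma sym_gl_sum_singles:
  "H = (\<Sum>M\<in>Poly_Mapping.keys H. Poly_Mapping.single M (Poly_Mapping.lookup H M))"
  by (rule poly_mapping_eqI)
     (auto simp: lookup_sum lookup_single when_def in_keys_iff)

lemma sym_gl_induct [case_names single add]:
  assumes "\<And>M c. P (Poly_Mapping.single M c)" "\<And>H K. P H \<Longrightarrow> P K \<Longrightarrow> P (H + K)"
  shows "P (H :: 'n sym_gl)"
proof -
  have "P 0" using assms(1)[of "{#}" 0] by simp
  then have "P (\<Sum>M\<in>A. Poly_Mapping.single M (f M))" for A f
    by (induction A rule: infinite_finite_induct) (simp_all add: assms)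
  then show ?thesis by (subst sym_gl_sum_singles)
qed

lemma sl_subst_mult: "sl_subst (H * K) = sl_subst H * sl_subst K"
proof (induction H rule: sym_gl_induct)
  case (single M c)
  show ?case
  proof (induction K rule: sym_gl_induct)
    case (single N d)
    show ?case by (simp add: mult_single sl_subst_single const_simps algebra_simps)
  qed (simp add: sl_subst_add algebra_simps)
qed (simp add: sl_subst_add algebra_simps)

lemma lin_add: "lin (y + z) = lin y + lin z"
  by (simp add: lin_def const_simps algebra_simps sum.distrib)

lemma lin_msc: "lin (msc c y) = const c * lin y"
  by (simp add: lin_def msc_def const_simps sum_distrib_left algebra_simps)

lemma lin_zero: "lin 0 = 0"
  by (simp add: lin_def const_simps)

lemma lin_sum: "lin (\<Sum>i\<in>I. f i) = (\<Sum>i\<in>I. lin (f i))"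
  by (induction I rule: infinite_finite_induct) (simp_all add: lin_zero lin_add)

lemma sl_part_add: "sl_part (y + z) = sl_part y + sl_part z"
  by (simp add: sl_part_def trace_add add_divide_distrib msc_simps)

lemma trace_msc: "trace (msc c y) = c * trace y"
  by (simp add: trace_def msc_def sum_distrib_left)

lemma sl_part_msc: "sl_part (msc c y) = msc c (sl_part y)"
  by (simp add: sl_part_def trace_msc) (simp add: vec_eq_iff msc_def algebra_simps)

lemma sl_part_zero: "sl_part 0 = 0"
  by (simp add: sl_part_def msc_simps trace_def)

lemma sl_part_sum: "sl_part (\<Sum>i\<in>I. f i) = (\<Sum>i\<in>I. sl_part (f i))"
  by (induction I rule: infinite_finite_induct) (simp_all add: sl_part_zero sl_part_add)

lemma sl_part_in_sl: "sl_part y \<in> sl"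
  by (simp add: sl_def sl_part_def trace_sub trace_msc trace_I)

lemma sl_part_sl: "y \<in> sl \<Longrightarrow> sl_part y = y"
  by (simp add: sl_def sl_part_def msc_simps)

lemma sl_part_one: "sl_part (mat 1 :: 'n::finite gl) = 0"
  by (simp add: sl_part_def trace_I msc_simps)

lemma sl_subst_lin: "sl_subst (lin y) = lin (sl_part y)"
proof -
  have "sl_subst (lin y) = (\<Sum>u\<in>UNIV. const (y $ fst u $ snd u) * lin (sl_part (munit u)))"
    by (simp add: lin_def[of y] sl_subst_sum gen_def const_mult sl_subst_single)
  also have "\<dots> = lin (sl_part (\<Sum>u\<in>UNIV. msc (y $ fst u $ snd u) (munit u)))"
    by (simp add: sl_part_sum sl_part_msc lin_sum lin_msc)
  finally show ?thesis by (simp add: gl_decomp)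
qed

lemma sl_subst_sym_sl: "H \<in> sym_sl \<Longrightarrow> sl_subst H = H"
proof (induction rule: sym_sl.induct)
  case (const c)
  show ?case by (simp add: const_def sl_subst_single)
qed (simp_all add: sl_subst_lin sl_part_sl sl_subst_add sl_subst_mult)

lemma sl_subst_in_sym_sl: "sl_subst H \<in> sym_sl"
proof (induction H rule: sym_gl_induct)
  case (single M c)
  have "(\<Prod>u\<in>#M. lin (sl_part (munit u))) \<in> sym_sl"
  proof (induction M)
    case empty
    show ?case using sym_sl.const[of 1] by (simp add: const_simps)
  qed (simp add: sym_sl.mult sym_sl.lin sl_part_in_sl)
  then show ?case by (simp add: sl_subst_single sym_sl.mult sym_sl.const)
qed (simp add: sl_subst_add sym_sl.add)

lemma lin_munit: "lin (munit u) = gen u"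
proof -
  have "lin (munit u) = (\<Sum>v\<in>UNIV. if v = u then gen u else 0)"
    unfolding lin_def by (intro sum.cong refl) (auto simp: munit_nth const_simps prod_eq_iff)
  then show ?thesis by simp
qed

lemma sl_subst_cong: "lin (mat 1) dvd H - sl_subst H"
proof (induction H rule: sym_gl_induct)
  case (single M c)
  have mon: "Poly_Mapping.single M 1 = (\<Prod>u\<in>#M. gen u)" for M :: "('a \<times> 'a) multiset"
  proof (induction M)
    case (add u M)
    have "Poly_Mapping.single (add_mset u M) (1 :: complex) = gen u * Poly_Mapping.single M 1"
      by (simp add: gen_def mult_single)
    then show ?case using add by simp
  qed simp
  have "lin (mat 1) dvd (\<Prod>u\<in>#M. gen u) - (\<Prod>u\<in>#M. lin (sl_part (munit u)))"
  proof (induction M)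
    case (add u M)
    let ?p = "\<Prod>u\<in>#M. gen u" and ?q = "\<Prod>u\<in>#M. lin (sl_part (munit u))"
    let ?c = "trace (munit u) / of_nat CARD('a)"
    have "munit u = sl_part (munit u) + msc ?c (mat 1)" by (simp add: sl_part_def)
    then have "gen u = lin (sl_part (munit u)) + const ?c * lin (mat 1)"
      by (metis lin_add lin_msc lin_munit)
    then have "gen u * ?p - lin (sl_part (munit u)) * ?q
      = lin (sl_part (munit u)) * (?p - ?q) + const ?c * lin (mat 1) * ?p"
      by (simp add: algebra_simps)
    then show ?case using add by (simp add: dvd_add dvd_mult)
  qed simp
  then have "lin (mat 1) dvd const c * ((\<Prod>u\<in>#M. gen u) - (\<Prod>u\<in>#M. lin (sl_part (munit u))))"
    by (rule dvd_mult)
  then show ?case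
    using const_mult[of c M 1] mon[of M] by (simp add: sl_subst_single algebra_simps)
next
  case (add H K)
  have "H + K - sl_subst (H + K) = (H - sl_subst H) + (K - sl_subst K)"
    by (simp add: sl_subst_add)
  then show ?case using add by (simp only: dvd_add)
qed

lemma sl_restriction_unique:
  assumes "H' \<in> sym_sl" "lin (mat 1) dvd H - H'"
  shows "H' = sl_subst H"
proof -
  obtain Q where "H - H' = lin (mat 1) * Q" using assms(2) by (rule dvdE)
  then have H: "H = H' + lin (mat 1) * Q" by (simp add: algebra_simps)
  show ?thesis
    by (subst H) (simp add: sl_subst_add sl_subst_mult sl_subst_lin sl_part_one lin_zero
        sl_subst_sym_sl[OF assms(1)])
qed

lemma sl_restriction_ex1: "\<exists>!H'. H' \<in> sym_sl \<and> lin (mat 1) dvd H - H'"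
  using sl_subst_in_sym_sl sl_subst_cong sl_restriction_unique by blast

end

theory Submission
  imports Defs
begin

text \<open>
  Up to the factor \<open>k!\<close>, the symmetrisation of \<open>\<Delta>\<^sub>k\<close> is the generalised Kronecker delta: its
  coefficient at \<open>E\<^bsub>i1 j1\<^esub> \<otimes> \<dots> \<otimes> E\<^bsub>ik jk\<^esub>\<close> is \<open>det (\<delta>(i\<^sub>a, j\<^sub>b))\<close>. It is invariant under
  simultaneous permutations of the pairs, changes sign when two of the \<open>j\<close>'s are exchanged, and
  contracting one pair of indices of a delta of length \<open>l + 1\<close> multiplies the delta of length \<open>l\<close> by
  \<open>n - l\<close>.

  Apply the adjoint factors to a matrix \<open>X\<close> one at a time. By these rules the result remains a
  combination of three sums, in which \<open>X\<close> is multiplied by a matrix unit from the left, from the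
  right, or from both sides. Passing to a word \<open>w\<close> with \<open>n - |w| - 1 = N\<close>, one more factor changes
  the coefficients \<open>(\<alpha>, \<beta>, \<gamma>)\<close> to \<open>(- N \<alpha>, N \<beta>, \<beta> - \<alpha>)\<close>. Starting with \<open>(1, -1, 0)\<close> for one
  factor, after an odd number of factors they are \<open>(c, -c, 0)\<close> with \<open>c\<close> a falling factorial, and this
  is \<open>c\<close> times the adjoint action.

  This proves the formula on \<open>gl\<^sub>n\<close>. It descends to \<open>sl\<^sub>n\<close> because the restriction applies the
  projection along \<open>I\<^sub>n\<close> to every tensor factor, which the adjoint factors do not see.
\<close>

section \<open>The generalised Kronecker delta\<close>

text \<open>This is the Leibniz expansion of a determinant. The index rows are functions, of which
  only the values below \<open>k\<close> matter: permuting a row is composition, and a further index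
  is a function update.\<close>

definition kronecker :: "nat \<Rightarrow> (nat \<Rightarrow> 'a) \<Rightarrow> (nat \<Rightarrow> 'a) \<Rightarrow> complex" where
  "kronecker k f g = (\<Sum>\<pi> | \<pi> permutes {..<k}. of_int (sign \<pi>) * (\<Prod>a<k. of_bool (f (\<pi> a) = g a)))"

definition kdelta :: "('a \<times> 'a) list \<Rightarrow> complex" where
  "kdelta w = kronecker (length w) (\<lambda>a. fst (w ! a)) (\<lambda>a. snd (w ! a))"

lemma kronecker_cong:
  assumes "\<And>a. a < k \<Longrightarrow> f a = f' a" "\<And>a. a < k \<Longrightarrow> g a = g' a"
  shows "kronecker k f g = kronecker k f' g'"
  unfolding kronecker_def
proof (intro sum.cong refl arg_cong2[of _ _ _ _ "(*)"] prod.cong)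
  fix \<pi> a assume "\<pi> \<in> {\<pi>. \<pi> permutes {..<k}}" "a \<in> {..<k}"
  then have "\<pi> a < k" "a < k" by (auto dest: permutes_in_image)
  then show "(of_bool (f (\<pi> a) = g a) :: complex) = of_bool (f' (\<pi> a) = g' a)"
    using assms by simp
qed

lemma kronecker_compose_left:
  assumes t: "\<tau> permutes {..<k}"
  shows "kronecker k (f \<circ> \<tau>) g = of_int (sign \<tau>) * kronecker k f g"
proof -
  have s: "of_int (sign (\<tau> \<circ> \<pi>)) = (of_int (sign \<tau>) * of_int (sign \<pi>) :: complex)"
    if "\<pi> permutes {..<k}" for \<pi>
    using that t by (simp add: sign_compose permutes_imp_permutation[OF finite_lessThan])
  have "kronecker k f g = (\<Sum>\<pi> | \<pi> permutes {..<k}. of_int (sign (\<tau> \<circ> \<pi>))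
      * (\<Prod>a<k. of_bool (f ((\<tau> \<circ> \<pi>) a) = g a)))"
    unfolding kronecker_def by (rule setum_permutations_compose_left[OF t])
  also have "\<dots> = of_int (sign \<tau>) * kronecker k (f \<circ> \<tau>) g"
    unfolding kronecker_def sum_distrib_left by (intro sum.cong refl) (simp add: s)
  \<comment> \<open>The sign still stands on the wrong side; being 1 or -1, it is its own
    inverse.\<close>
  finally show ?thesis
    by (cases \<tau> rule: sign_cases) simp_all
qed

text \<open>Replacing \<pi> by \<open>\<pi> \<circ> \<tau>\<close> makes every factor depend on
  \<open>\<tau> a\<close> only, so the product is merely reordered.\<close>

lemma kronecker_compose_right:
  assumes t: "\<tau> permutes {..<k}"
  shows "kronecker k f (g \<circ> \<tau>) = of_int (sign \<tau>) * kronecker k f g"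
proof -
  have s: "of_int (sign (\<pi> \<circ> \<tau>)) = (of_int (sign \<pi>) * of_int (sign \<tau>) :: complex)"
    if "\<pi> permutes {..<k}" for \<pi>
    using that t by (simp add: sign_compose permutes_imp_permutation[OF finite_lessThan])
  have "kronecker k f (g \<circ> \<tau>) = (\<Sum>\<pi> | \<pi> permutes {..<k}. of_int (sign (\<pi> \<circ> \<tau>)) *
      (\<Prod>a<k. of_bool (f (\<pi> (\<tau> a)) = g (\<tau> a))))"
    unfolding kronecker_def by (subst sum_permutations_compose_right[OF t]) simp
  also have "\<dots> = (\<Sum>\<pi> | \<pi> permutes {..<k}. of_int (sign (\<pi> \<circ> \<tau>)) * (\<Prod>a<k. of_bool (f (\<pi> a) = g a)))"
    by (intro sum.cong refl arg_cong2[of _ _ _ _ "(*)"])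
       (subst prod.permute[OF t], simp add: o_def)
  also have "\<dots> = of_int (sign \<tau>) * kronecker k f g"
    unfolding kronecker_def sum_distrib_left by (intro sum.cong refl) (simp add: s)
  finally show ?thesis .
qed

text \<open>Exchanging two positions with equal values leaves \<open>f\<close> unchanged but flips
  the sign.\<close>

lemma kronecker_eq_0:
  assumes "\<not> inj_on f {..<k}"
  shows "kronecker k f g = 0"
proof -
  from assms obtain a b where ab: "a < k" "b < k" "a \<noteq> b" "f a = f b"
    by (auto simp: inj_on_def)
  let ?t = "Transposition.transpose a b"
  have "f \<circ> ?t = f" using ab by (auto simp: fun_eq_iff Transposition.transpose_def)
  moreover have "?t permutes {..<k}" using ab by (simp add: permutes_swap_id)
  ultimately have "kronecker k f g = - kronecker k f g"
    using kronecker_compose_left[of ?t k f g] ab by (simp add: sign_swap_id)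
  then show ?thesis by simp
qed

text \<open>Both index rows undergo the same permutation, so its sign enters twice and
  cancels.\<close>

lemma kdelta_mset:
  assumes "mset v = mset w"
  shows "kdelta v = kdelta w"
proof -
  obtain p where p: "p permutes {..<length w}" "permute_list p w = v"
    using mset_eq_permutation[OF assms] by metis
  have "kdelta v = kronecker (length w) ((\<lambda>a. fst (w ! a)) \<circ> p) ((\<lambda>a. snd (w ! a)) \<circ> p)"
    using p by (auto simp: kdelta_def permute_list_nth intro!: kronecker_cong)
  then show ?thesis
    using p by (cases p rule: sign_cases)
      (simp_all add: kronecker_compose_left kronecker_compose_right kdelta_def)
qed

lemma kdelta_swap: "kdelta ((i, j) # (p, q) # w) = - kdelta ((i, q) # (p, j) # w)"
proof -
  let ?v = "(i, q) # (p, j) # w" and ?t = "Transposition.transpose 0 (Suc 0)"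
  have t: "?t permutes {..<length ?v}" by (rule permutes_swap_id) auto
  have "kdelta ((i, j) # (p, q) # w)
      = kronecker (length ?v) (\<lambda>a. fst (?v ! a)) ((\<lambda>a. snd (?v ! a)) \<circ> ?t)"
    unfolding kdelta_def length_Cons
    by (intro kronecker_cong) (auto simp: nth_Cons' Transposition.transpose_def)
  then show ?thesis
    by (simp only: kronecker_compose_right[OF t]) (simp add: sign_swap_id kdelta_def)
qed

text \<open>A permutation of \<open>k + 1\<close> positions either fixes \<open>k\<close>, giving
  the shorter delta for every \<open>x\<close>, or is a permutation of the first \<open>k\<close>
  positions followed by a transposition of \<open>k\<close> and some \<open>b < k\<close>. The
  latter forces \<open>x = f b\<close> and gives minus a term of the shorter delta.\<close>

lemma kronecker_Suc_contract:
  fixes f g :: "nat \<Rightarrow> 'a::finite"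
  shows "(\<Sum>x\<in>UNIV. kronecker (Suc k) (f(k := x)) (g(k := x)))
    = (of_nat CARD('a) - of_nat k) * kronecker k f g"
proof -
  define F where "F x \<pi> = of_int (sign \<pi>) * (\<Prod>a<Suc k. of_bool ((f(k := x)) (\<pi> a)
      = (g(k := x)) a) :: complex)"
    for x :: 'a and \<pi>
  define G where "G \<pi> = of_int (sign \<pi>) * (\<Prod>a<k. of_bool (f (\<pi> a) = g a) :: complex)" for \<pi>
  have F_diag: "F x q = G q" if q: "q permutes {..<k}" for x q
  proof -
    have "q a \<noteq> k" if "a < k" for a using permutes_in_image[OF q, of a] that by auto
    moreover have "q k = k" using q by (simp add: permutes_def)
    ultimately show ?thesis by (simp add: F_def G_def)
  qed
  have F_off: "F x (Transposition.transpose k b \<circ> q) = (if x = f b then - G q else 0)"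
    if q: "q permutes {..<k}" and b: "b < k" for x q b
  proof -
    have qk: "q k = k" using q by (simp add: permutes_def)
    have s: "sign (Transposition.transpose k b \<circ> q) = - sign q"
      using b q by (simp add: sign_compose sign_swap_id permutation_swap_id
          permutes_imp_permutation[OF finite_lessThan])
    show ?thesis
    proof (cases "x = f b")
      case True
      \<comment> \<open>The position that \<open>q\<close> sends to \<open>b\<close> now goes to
        \<open>k\<close>, where the updated function has the same value
        \<open>x = f b\<close>.\<close>
      have "(f(k := x)) (Transposition.transpose k b (q a)) = f (q a)" if "a < k" for a
        using permutes_in_image[OF q, of a] that True b
        by (auto simp: Transposition.transpose_def)
      then show ?thesis
        using True b by (simp add: F_def G_def s qk)
    next
      case False
      \<comment> \<open>The factor at position \<open>k\<close> compares \<open>f b\<close> with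
        \<open>x\<close> and vanishes.\<close>
      then show ?thesis using b by (simp add: F_def qk)
    qed
  qed
  have "kronecker (Suc k) (f(k := x)) (g(k := x)) = (\<Sum>q | q permutes {..<k}. G q)
      + (\<Sum>b<k. \<Sum>q | q permutes {..<k}. if x = f b then - G q else 0)" for x
  proof -
    have "kronecker (Suc k) (f(k := x)) (g(k := x)) = sum (F x) {\<pi>. \<pi> permutes insert k {..<k}}"
      by (simp add: kronecker_def F_def lessThan_Suc)
    also have "\<dots> = (\<Sum>q | q permutes {..<k}. F x q)
        + (\<Sum>b<k. \<Sum>q | q permutes {..<k}. F x (Transposition.transpose k b \<circ> q))"
      by (subst sum_over_permutations_insert) auto
    also have "\<dots> = (\<Sum>q | q permutes {..<k}. G q)
        + (\<Sum>b<k. \<Sum>q | q permutes {..<k}. if x = f b then - G q else 0)"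
      by (intro arg_cong2[of _ _ _ _ "(+)"] sum.cong refl) (auto simp: F_diag F_off)
    finally show ?thesis .
  qed
  then have "(\<Sum>x\<in>UNIV. kronecker (Suc k) (f(k := x)) (g(k := x)))
     = of_nat CARD('a) * (\<Sum>q | q permutes {..<k}. G q)
      + (\<Sum>x\<in>UNIV. \<Sum>b<k. \<Sum>q | q permutes {..<k}. if x = f b then - G q else 0)"
    by (simp add: sum.distrib)
  also have "(\<Sum>x\<in>UNIV. \<Sum>b<k. \<Sum>q | q permutes {..<k}. if x = f b then - G q else 0)
     = (\<Sum>b<k. \<Sum>q | q permutes {..<k}. \<Sum>x\<in>UNIV. if x = f b then - G q else 0)"
    by (subst sum.swap, intro sum.cong refl, subst sum.swap) simp
  finally show ?thesis
    by (simp add: sum_negf algebra_simps kronecker_def G_def)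
qed

lemma kdelta_contract:
  "(\<Sum>x\<in>UNIV. kdelta ((x, x) # w)) = (of_nat CARD('a) - of_nat (length w)) * kdelta (w :: ('a::finite \<times> 'a) list)"
proof -
  have "kdelta ((x, x) # w) = kronecker (Suc (length w)) ((\<lambda>a. fst (w ! a))(length w := x))
      ((\<lambda>a. snd (w ! a))(length w := x))" for x
  proof -
    \<comment> \<open>The contraction rule concerns the last position, so the pair is moved
      there.\<close>
    have "kdelta ((x, x) # w) = kdelta (w @ [(x, x)])" by (rule kdelta_mset) simp
    then show ?thesis
      by (auto simp: kdelta_def nth_append intro!: kronecker_cong)
  qed
  then show ?thesis by (simp add: kronecker_Suc_contract kdelta_def)
qed

text \<open>A summed index that is spread over two pairs is gathered into one pair at the head, at
  the cost of a sign, so that \<open>kdelta_contract\<close> applies. The pair \<open>u\<close> is a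
  bystander, needed for the mixed sums.\<close>

lemma kdelta_cycle:
  "kdelta ((q, j) # (s, q) # w) = - kdelta ((q, q) # (s, j) # w)"
  "kdelta ((q, j) # u # (s, q) # w) = - kdelta ((q, q) # u # (s, j) # w)"
  "kdelta ((i, p) # (p, t) # w) = - kdelta ((p, p) # (i, t) # w)"
  "kdelta (u # (i, p) # (p, t) # w) = - kdelta ((p, p) # u # (i, t) # w)"
proof -
  show 1: "kdelta ((q, j) # (s, q) # w) = - kdelta ((q, q) # (s, j) # w)" for q j s w
    by (rule kdelta_swap)
  have "kdelta ((q, j) # u # (s, q) # w) = kdelta ((q, j) # (s, q) # u # w)"
    by (rule kdelta_mset) simp
  also have "\<dots> = - kdelta ((q, q) # (s, j) # u # w)" by (rule 1)
  also have "kdelta ((q, q) # (s, j) # u # w) = kdelta ((q, q) # u # (s, j) # w)"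
    by (rule kdelta_mset) simp
  finally show "kdelta ((q, j) # u # (s, q) # w) = - kdelta ((q, q) # u # (s, j) # w)" .
  show 2: "kdelta ((i, p) # (p, t) # w) = - kdelta ((p, p) # (i, t) # w)" for i p t w
  proof -
    have "kdelta ((i, p) # (p, t) # w) = kdelta ((p, t) # (i, p) # w)" by (rule kdelta_mset) simp
    then show ?thesis by (simp add: 1)
  qed
  have "kdelta (u # (i, p) # (p, t) # w) = kdelta ((i, p) # (p, t) # u # w)"
    by (rule kdelta_mset) simp
  also have "\<dots> = - kdelta ((p, p) # (i, t) # u # w)" by (rule 2)
  also have "kdelta ((p, p) # (i, t) # u # w) = kdelta ((p, p) # u # (i, t) # w)"
    by (rule kdelta_mset) simp
  finally show "kdelta (u # (i, p) # (p, t) # w) = - kdelta ((p, p) # u # (i, t) # w)" .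
qed

section \<open>Adjoint factors applied to the Kronecker delta\<close>

text \<open>Left minus right contraction is one more adjoint factor, summed over all matrix
  units.\<close>

definition left_contract :: "('n \<times> 'n \<Rightarrow> 'n gl) \<Rightarrow> 'n::finite gl" where
  "left_contract M = (\<Sum>u\<in>UNIV. munit u ** M u)"

definition right_contract :: "('n \<times> 'n \<Rightarrow> 'n gl) \<Rightarrow> 'n::finite gl" where
  "right_contract M = (\<Sum>u\<in>UNIV. M u ** munit u)"

lemma munit_mult_nth:
  "(munit u ** M) $ s $ t = (if s = fst u then M $ snd u $ t else 0)"
  "(M ** munit u) $ s $ t = (if t = snd u then M $ s $ fst u else 0)"
  by (auto simp: matrix_matrix_mult_def munit_nth if_distrib if_distribR cong: if_cong)

lemma left_contract_nth: "left_contract M $ s $ t = (\<Sum>q\<in>UNIV. M (s, q) $ q $ t)"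
proof -
  have "left_contract M $ s $ t = (\<Sum>p\<in>UNIV. \<Sum>q\<in>UNIV. if s = p then M (p, q) $ q $ t else 0)"
    by (simp add: left_contract_def munit_mult_nth sum.cartesian_product split_def
        del: sum.delta sum.delta' cong: if_cong)
  then show ?thesis by (subst (asm) sum.swap) simp
qed

lemma right_contract_nth: "right_contract M $ s $ t = (\<Sum>p\<in>UNIV. M (p, t) $ s $ p)"
proof -
  have "right_contract M $ s $ t = (\<Sum>p\<in>UNIV. \<Sum>q\<in>UNIV. if t = q then M (p, q) $ s $ p else 0)"
    by (simp add: right_contract_def munit_mult_nth sum.cartesian_product split_def
        del: sum.delta sum.delta' cong: if_cong)
  then show ?thesis by simp
qed

lemma sum_rotate: "(\<Sum>q\<in>A. \<Sum>j\<in>B. \<Sum>i\<in>C. f q j i) = (\<Sum>j\<in>B. \<Sum>i\<in>C. \<Sum>q\<in>A. f q j i)"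
  by (subst sum.swap, intro sum.cong refl, rule sum.swap)

section \<open>Three sums closed under a further adjoint factor\<close>

context
  fixes X :: "'n::finite gl"
begin

text \<open>If \<open>K\<close> is the matrix with entries \<open>kdelta ((s, j) # w)\<close>, then
  \<open>left_term w\<close> is \<open>K ** X\<close> and \<open>right_term w\<close> is
  \<open>X ** K\<close>. In \<open>mixed_term\<close>, \<open>X\<close> stands between two matrix
  units whose indices share one delta.\<close>

definition left_term :: "('n \<times> 'n) list \<Rightarrow> 'n gl" where
  "left_term w = (\<chi> s t. \<Sum>j\<in>UNIV. kdelta ((s, j) # w) * X $ j $ t)"

definition right_term :: "('n \<times> 'n) list \<Rightarrow> 'n gl" where
  "right_term w = (\<chi> s t. \<Sum>i\<in>UNIV. kdelta ((i, t) # w) * X $ s $ i)"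

definition mixed_term :: "('n \<times> 'n) list \<Rightarrow> 'n gl" where
  "mixed_term w = (\<chi> s t. \<Sum>j\<in>UNIV. \<Sum>i\<in>UNIV. kdelta ((s, j) # (i, t) # w) * X $ j $ i)"

abbreviation (input) codim :: "('n \<times> 'n) list \<Rightarrow> complex" where
  "codim w \<equiv> of_nat CARD('n) - of_nat (length w)"

text \<open>The diagonal pair is contracted against \<open>(s, j) # w\<close>, which is one longer
  than \<open>w\<close>; hence the 1, while the exchange gives the minus sign.\<close>

lemma left_contract_left: "left_contract (\<lambda>u. left_term (u # w)) = msc (- (codim w - 1)) (left_term w)"
proof -
  have "(\<Sum>q\<in>UNIV. \<Sum>j\<in>UNIV. kdelta ((q, j) # (s, q) # w) * X $ j $ t)
      = (\<Sum>j\<in>UNIV. - (\<Sum>q\<in>UNIV. kdelta ((q, q) # (s, j) # w)) * X $ j $ t)" for s t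
    by (subst sum.swap) (simp add: kdelta_cycle(1) sum_distrib_right sum_negf)
  then show ?thesis
    by (simp add: vec_eq_iff left_contract_nth left_term_def kdelta_contract msc_def
        sum_distrib_left algebra_simps)
qed

text \<open>The new unit acts on the other side of \<open>X\<close>, so its index is summed against
  \<open>X\<close> and nothing contracts.\<close>

lemma right_contract_left: "right_contract (\<lambda>u. left_term (u # w)) = mixed_term w"
  by (simp add: vec_eq_iff right_contract_nth left_term_def mixed_term_def) (auto intro: sum.swap)

lemma left_contract_right: "left_contract (\<lambda>u. right_term (u # w)) = mixed_term w"
proof -
  have "kdelta ((i, t) # (s, q) # w) = kdelta ((s, q) # (i, t) # w)" for i t s q
    by (rule kdelta_mset) simp
  then show ?thesis
    by (simp add: vec_eq_iff left_contract_nth right_term_def mixed_term_def)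
qed

lemma right_contract_right: "right_contract (\<lambda>u. right_term (u # w))
    = msc (- (codim w - 1)) (right_term w)"
proof -
  have "(\<Sum>p\<in>UNIV. \<Sum>i\<in>UNIV. kdelta ((i, p) # (p, t) # w) * X $ s $ i)
      = (\<Sum>i\<in>UNIV. - (\<Sum>p\<in>UNIV. kdelta ((p, p) # (i, t) # w)) * X $ s $ i)" for s t
    by (subst sum.swap) (simp add: kdelta_cycle(3) sum_distrib_right sum_negf)
  then show ?thesis
    by (simp add: vec_eq_iff right_contract_nth right_term_def kdelta_contract msc_def
        sum_distrib_left algebra_simps)
qed

text \<open>After the contraction two pairs remain in front of \<open>w\<close>, hence 2 in place of
  1.\<close>

lemma left_contract_mixed: "left_contract (\<lambda>u. mixed_term (u # w))
    = msc (- (codim w - 2)) (mixed_term w)"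
proof -
  have "(\<Sum>q\<in>UNIV. \<Sum>j\<in>UNIV. \<Sum>i\<in>UNIV. kdelta ((q, j) # (i, t) # (s, q) # w) * X $ j $ i)
      = (\<Sum>j\<in>UNIV. \<Sum>i\<in>UNIV. - (\<Sum>q\<in>UNIV. kdelta ((q, q) # (i, t) # (s, j) # w)) * X $ j $ i)" for s t
    by (subst sum_rotate) (simp add: kdelta_cycle(2) sum_distrib_right sum_negf)
  also have "\<dots> s t = - (codim w - 2) * (\<Sum>j\<in>UNIV. \<Sum>i\<in>UNIV. kdelta ((s, j) # (i, t) # w) * X $ j $ i)" for s t
  proof -
    have "kdelta ((i, t) # (s, j) # w) = kdelta ((s, j) # (i, t) # w)" for i j
      by (rule kdelta_mset) simp
    then show ?thesis
      by (simp add: kdelta_contract sum_distrib_left algebra_simps)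
  qed
  finally show ?thesis
    by (simp add: vec_eq_iff left_contract_nth mixed_term_def msc_def)
qed

text \<open>The multiple is the same as on the left, so an adjoint factor annihilates mixed
  terms.\<close>

lemma right_contract_mixed: "right_contract (\<lambda>u. mixed_term (u # w))
    = msc (- (codim w - 2)) (mixed_term w)"
proof -
  have "(\<Sum>p\<in>UNIV. \<Sum>j\<in>UNIV. \<Sum>i\<in>UNIV. kdelta ((s, j) # (i, p) # (p, t) # w) * X $ j $ i)
      = (\<Sum>j\<in>UNIV. \<Sum>i\<in>UNIV. - (\<Sum>p\<in>UNIV. kdelta ((p, p) # (s, j) # (i, t) # w)) * X $ j $ i)" for s t
    by (subst sum_rotate) (simp add: kdelta_cycle(4) sum_distrib_right sum_negf)
  then show ?thesis
    by (simp add: vec_eq_iff right_contract_nth mixed_term_def kdelta_contract msc_def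
        sum_distrib_left algebra_simps)
qed

text \<open>The outermost factor belongs to the first letter \<open>u\<close>. By symmetry of the
  delta, \<open>u\<close> may be moved behind the other adjoint letters and counted as part of the
  word.\<close>

lemma ad_tensor_kdelta_Suc:
  "ad_tensor (Suc m) kdelta w X
    = left_contract (\<lambda>u. ad_tensor m kdelta (u # w) X)
    - right_contract (\<lambda>u. ad_tensor m kdelta (u # w) X)"
proof -
  have "kdelta (u # v @ w) = kdelta (v @ u # w)" for u :: "'n \<times> 'n" and v
    by (rule kdelta_mset) simp
  then have "ad_tensor (Suc m) kdelta w X = (\<Sum>u\<in>UNIV. ad (munit u) (ad_tensor m kdelta (u # w) X))"
    by (simp add: ad_tensor_def sum_lists_Suc ad_prod_simps ad_sum_right ad_msc)
  then show ?thesis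
    by (simp add: ad_def left_contract_def right_contract_def sum_subtractf)
qed

lemma contract_msc:
  "left_contract (\<lambda>u. msc c (M u)) = msc c (left_contract M)"
  "right_contract (\<lambda>u. msc c (M u)) = msc c (right_contract M)"
  by (simp_all add: vec_eq_iff left_contract_nth right_contract_nth msc_def sum_distrib_left)

lemma contract_add:
  "left_contract (\<lambda>u. M u + N u) = left_contract M + left_contract N"
  "right_contract (\<lambda>u. M u + N u) = right_contract M + right_contract N"
  by (simp_all add: vec_eq_iff left_contract_nth right_contract_nth sum.distrib)

lemma contract_diff:
  "left_contract (\<lambda>u. M u - N u) = left_contract M - left_contract N"
  "right_contract (\<lambda>u. M u - N u) = right_contract M - right_contract N"
  by (simp_all add: vec_eq_iff left_contract_nth right_contract_nth sum_subtractf)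

lemma ad_tensor_kdelta_1: "ad_tensor 1 kdelta w X = left_term w - right_term w"
proof -
  have "ad_tensor 0 kdelta w X = msc (kdelta w) X" for w
    by (simp add: ad_tensor_def ad_prod_simps)
  then show ?thesis
    unfolding One_nat_def ad_tensor_kdelta_Suc
    by (simp add: vec_eq_iff left_contract_nth right_contract_nth left_term_def right_term_def msc_def)
qed

text \<open>The induction adds two factors at a time: mixed terms appear after the first and
  disappear after the second.\<close>

lemma ad_tensor_kdelta_odd:
  "ad_tensor (2 * r + 1) kdelta w X
    = msc (\<Prod>a<2 * r. codim w - 1 - of_nat a) (left_term w - right_term w)"
proof (induction r arbitrary: w)
  case 0
  show ?case using ad_tensor_kdelta_1 by (simp add: msc_simps)
next
  case (Suc r)
  \<comment> \<open>The induction hypothesis is used at \<open>u # w\<close>, which lowers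
    \<open>codim\<close> by one.\<close>
  have even: "ad_tensor (Suc (2 * r + 1)) kdelta w X
      = msc (\<Prod>a<2 * r. codim w - 2 - of_nat a)
          (msc (- (codim w - 1)) (left_term w + right_term w) - msc 2 (mixed_term w))" for w
    unfolding ad_tensor_kdelta_Suc Suc.IH
    by (simp add: contract_msc contract_diff left_contract_left left_contract_right
        right_contract_left right_contract_right)
       (simp add: vec_eq_iff msc_def algebra_simps)
  have "ad_tensor (2 * Suc r + 1) kdelta w X = ad_tensor (Suc (Suc (2 * r + 1))) kdelta w X"
    by simp
  also have "\<dots> = msc (\<Prod>a<2 * r. codim w - 3 - of_nat a)
      (msc (codim w - 2) (msc (codim w - 1) (left_term w - right_term w)))"
    unfolding ad_tensor_kdelta_Suc[of "Suc (2 * r + 1)"] even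
    by (simp add: contract_msc contract_diff contract_add left_contract_left left_contract_right
        right_contract_left right_contract_right left_contract_mixed right_contract_mixed)
       (simp add: vec_eq_iff msc_def algebra_simps)
  \<comment> \<open>The two new factors are the first two of the longer product; the others shift by
    two.\<close>
  also have "\<dots> = msc (\<Prod>a<2 * Suc r. codim w - 1 - of_nat a) (left_term w - right_term w)"
    by (simp add: msc_simps prod.lessThan_Suc_shift algebra_simps del: prod.lessThan_Suc)
  finally show ?case .
qed

end

section \<open>Symmetrisation of the coefficients of the characteristic polynomial\<close>

text \<open>In each Leibniz term, let \<open>S\<close> be the rows from which the entry of the
  generic matrix is chosen. The other rows contribute \<open>q\<close> only if \<open>p\<close>
  fixes them, so \<open>p\<close> permutes \<open>S\<close> and the power of \<open>q\<close>
  determines \<open>card S\<close>.\<close>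

lemma Delta_eq_sum_minors:
  assumes k: "k \<le> CARD('n)"
  shows "Delta k = (\<Sum>S | card S = k. \<Sum>p | p permutes S. of_int (sign p)
      * (\<Prod>i\<in>S. gen (i, p i)) :: 'n::finite sym_gl)"
proof -
  let ?n = "CARD('n)"
  let ?P = "{p :: 'n \<Rightarrow> 'n. p permutes UNIV}"
  have minor: "coeff (\<Prod>i\<in>UNIV. mat [:0, 1 :: 'n sym_gl:] $ i $ p i - [:gen (i, p i):]) (?n - k)
      = (-1) ^ k * (\<Sum>S | card S = k. if p permutes S then \<Prod>i\<in>S. gen (i, p i) else 0)"
    if p: "p permutes UNIV" for p :: "'n \<Rightarrow> 'n"
  proof -
    have 1: "(\<Prod>i\<in>S. [:- gen (i, p i):]) = [:(-1) ^ card S * (\<Prod>i\<in>S. gen (i, p i)):]" for S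
      by (induction S rule: infinite_finite_induct) simp_all
    have 2: "(\<Prod>i\<in>UNIV - S. if i = p i then [:0, 1:] else 0)
      = (if p permutes S then monom 1 (?n - card S) else 0 :: 'n sym_gl poly)" for S
    proof (cases "p permutes S")
      case True
      then have "(\<Prod>i\<in>UNIV - S. if i = p i then [:0, 1:] else 0) = (\<Prod>i\<in>UNIV - S. [:0, 1 :: 'n sym_gl:])"
        by (intro prod.cong refl) (auto simp: permutes_def)
      then show ?thesis
        using True by (simp add: card_Diff_subset monom_altdef)
    next
      case False
      then have "\<exists>i. i \<notin> S \<and> p i \<noteq> i" using p unfolding permutes_def by auto
      then show ?thesis using False by (auto intro!: prod_zero) (metis DiffI UNIV_I)
    qed
    have "coeff (\<Prod>i\<in>UNIV. mat [:0, 1 :: 'n sym_gl:] $ i $ p i - [:gen (i, p i):]) (?n - k)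
       = coeff (\<Prod>i\<in>UNIV. [:- gen (i, p i):] + (if i = p i then [:0, 1:] else 0)) (?n - k)"
      by (intro arg_cong2[of _ _ _ _ coeff] prod.cong refl) (simp add: mat_def)
    also have "\<dots> = (\<Sum>S\<in>UNIV. coeff ([:(-1) ^ card S * (\<Prod>i\<in>S. gen (i, p i)):]
         * (if p permutes S then monom 1 (?n - card S) else 0)) (?n - k))"
      by (subst prod_add) (simp_all add: 1 2 coeff_sum)
    also have "\<dots> = (\<Sum>S\<in>UNIV. if card S = k then (-1) ^ k
        * (if p permutes S then \<Prod>i\<in>S. gen (i, p i) else 0) else 0)"
    proof (intro sum.cong refl)
      fix S :: "'n set"
      \<comment> \<open>This bound makes the truncated exponents \<open>?n - card S\<close> and
        \<open>?n - k\<close> agree only for \<open>card S = k\<close>.\<close>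
      have "card S \<le> ?n" by (intro card_mono) auto
      then show "coeff ([:(-1) ^ card S * (\<Prod>i\<in>S. gen (i, p i)):]
         * (if p permutes S then monom 1 (?n - card S) else 0)) (?n - k)
         = (if card S = k then (-1) ^ k * (if p permutes S then \<Prod>i\<in>S. gen (i, p i) else 0) else 0)"
        using k by auto
    qed
    also have "\<dots> = (-1) ^ k * (\<Sum>S | card S = k. if p permutes S then \<Prod>i\<in>S. gen (i, p i) else 0)"
      unfolding sum_distrib_left by (subst sum.inter_filter[symmetric]) simp_all
    finally show ?thesis .
  qed
  have "Delta k = (-1) ^ k * (\<Sum>p\<in>?P. of_int (sign p) *
      ((-1) ^ k * (\<Sum>S | card S = k. if p permutes S then \<Prod>i\<in>S. gen (i, p i) else 0)))"
    using k by (simp add: Delta_def generic_charpoly_def det_def coeff_sum of_int_poly minor)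
  also have "\<dots> = (\<Sum>p\<in>?P. \<Sum>S | card S = k. if p permutes S then of_int (sign p)
      * (\<Prod>i\<in>S. gen (i, p i)) else 0)"
    unfolding sum_distrib_left
    by (intro sum.cong refl) (simp add: mult.left_commute flip: power_mult_distrib mult.assoc)
  also have "\<dots> = (\<Sum>S | card S = k. \<Sum>p\<in>?P. if p permutes S then of_int (sign p)
      * (\<Prod>i\<in>S. gen (i, p i)) else 0)"
    by (rule sum.swap)
  also have "\<dots> = (\<Sum>S | card S = k. \<Sum>p | p permutes S. of_int (sign p) * (\<Prod>i\<in>S. gen (i, p i)))"
  proof (rule sum.cong[OF refl])
    fix S :: "'n set"
    have "{p \<in> ?P. p permutes S} = {p. p permutes S}"
      by (auto intro: permutes_subset)
    then show "(\<Sum>p\<in>?P. if p permutes S then of_int (sign p) * (\<Prod>i\<in>S. gen (i, p i)) else 0)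
        = (\<Sum>p | p permutes S. of_int (sign p) * (\<Prod>i\<in>S. gen (i, p i)) :: 'n sym_gl)"
      by (simp add: sum.inter_filter[symmetric])
  qed
  finally show ?thesis .
qed

section \<open>Coefficients of a symmetrised minor\<close>

lemma pure_map_munit: "pure (map munit v) w = of_bool (v = w)"
proof (induction v arbitrary: w)
  case Nil
  show ?case by (simp add: pure_def)
next
  case (Cons u v)
  show ?case
  proof (cases w)
    case Nil
    then show ?thesis by (simp add: pure_def)
  next
    case (Cons u' w')
    then show ?thesis using Cons.IH[of w'] by (auto simp: pure_Cons munit_nth prod_eq_iff)
  qed
qed

text \<open>With distinct letters, exactly one permutation produces a given rearrangement.\<close>

lemma sym_pure_distinct:
  assumes us: "distinct us"
  shows "sym_pure (map munit us) w = (if mset w = mset us then 1 / fact (length us) else 0)"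
proof -
  let ?k = "length us"
  let ?s = "\<Sum>\<sigma> | \<sigma> permutes {..<?k}. of_bool (permute_list \<sigma> us = w) :: complex"
  have "sym_pure (map munit us) w = 1 / fact ?k * ?s"
    by (simp add: sym_pure_def permute_list_map pure_map_munit)
  moreover have "?s = of_bool (mset w = mset us)"
  proof (cases "mset w = mset us")
    case True
    then obtain \<tau> where t: "\<tau> permutes {..<?k}" "permute_list \<tau> us = w"
      by (rule mset_eq_permutation)
    have "permute_list \<sigma> us = w \<longleftrightarrow> \<sigma> = \<tau>" if s: "\<sigma> permutes {..<?k}" for \<sigma>
    proof
      assume eq: "permute_list \<sigma> us = w"
      have "us ! \<sigma> a = us ! \<tau> a" if "a < ?k" for a
        using eq t s that by (metis permute_list_nth)
      then have "\<sigma> a = \<tau> a" if "a < ?k" for a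
        using us that permutes_in_image[OF s, of a] permutes_in_image[OF t(1), of a]
        by (metis lessThan_iff nth_eq_iff_index_eq)
      moreover have "\<sigma> a = \<tau> a" if "\<not> a < ?k" for a
        using s t(1) that by (simp add: permutes_def)
      ultimately show "\<sigma> = \<tau>" by blast
    qed (use t in simp)
    then have "?s = (\<Sum>\<sigma> | \<sigma> permutes {..<?k}. if \<sigma> = \<tau> then 1 else 0)"
      by (intro sum.cong) auto
    then show ?thesis using t True by (simp add: finite_permutations)
  next
    case False
    then have "permute_list \<sigma> us \<noteq> w" if "\<sigma> permutes {..<?k}" for \<sigma>
      using mset_permute_list[OF that] by auto
    then show ?thesis using False by (auto intro!: sum.neutral)
  qed
  ultimately show ?thesis by simp
qed

text \<open>The monomial has distinct letters \<open>(i, p i)\<close>; the condition says that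
  \<open>w\<close> lists the graph of \<open>p\<close> over \<open>S\<close> in some order.\<close>

lemma symmetrise_minor:
  fixes p :: "'n::finite \<Rightarrow> 'n"
  shows "symmetrise (of_int (sign p) * (\<Prod>i\<in>S. gen (i, p i))) w
    = (if distinct (map fst w) \<and> fst ` set w = S \<and> (\<forall>u\<in>set w. p (fst u) = snd u)
       then of_int (sign p) / fact (card S) else 0)"
proof -
  obtain xs where xs: "set xs = S" "distinct xs"
    using finite_distinct_list[of S] by auto
  let ?us = "map (\<lambda>i. (i, p i)) xs"
  have "(\<Prod>i\<in>set ys. gen (i, p i)) = Poly_Mapping.single (mset (map (\<lambda>i. (i, p i)) ys)) 1"
    if "distinct ys" for ys
    using that by (induction ys) (simp_all add: gen_def mult_single)
  from this[OF xs(2)] have "(\<Prod>i\<in>S. gen (i, p i)) = Poly_Mapping.single (mset ?us) 1"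
    unfolding xs(1) .
  then have "of_int (sign p) * (\<Prod>i\<in>S. gen (i, p i)) = Poly_Mapping.single (mset ?us) (of_int (sign p))"
    by (cases p rule: sign_cases) (simp_all add: single_uminus)
  moreover have "mset w = mset ?us \<longleftrightarrow>
      distinct (map fst w) \<and> fst ` set w = S \<and> (\<forall>u\<in>set w. p (fst u) = snd u)"
  proof
    assume eq: "mset w = mset ?us"
    then have "mset (map fst w) = mset (map fst ?us)" by (simp only: mset_map)
    then have "mset (map fst w) = mset xs" by (simp add: o_def)
    then have "distinct (map fst w)" "set (map fst w) = S"
      using xs mset_eq_imp_distinct_iff mset_eq_setD by blast+
    moreover have "set w = set ?us" using eq by (rule mset_eq_setD)
    ultimately show "distinct (map fst w) \<and> fst ` set w = S \<and> (\<forall>u\<in>set w. p (fst u) = snd u)"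
      by auto
  next
    assume *: "distinct (map fst w) \<and> fst ` set w = S \<and> (\<forall>u\<in>set w. p (fst u) = snd u)"
    then have "set w = (\<lambda>i. (i, p i)) ` S"
      by (force simp: image_iff)
    moreover have "distinct w" using * by (simp add: distinct_map)
    moreover have "distinct ?us" using xs by (simp add: distinct_map inj_on_def)
    ultimately show "mset w = mset ?us"
      using xs(1) by (subst set_eq_iff_mset_eq_distinct[symmetric]) simp_all
  qed
  moreover have "distinct ?us" "length ?us = card S"
    using xs by (simp_all add: distinct_map inj_on_def flip: distinct_card)
  ultimately show ?thesis
    by (simp only: symmetrise_single sym_pure_distinct) simp
qed

text \<open>Conjugation by \<open>f\<close> is undone by conjugation by its inverse.\<close>

lemma bij_betw_map_permutation:
  assumes "bij_betw f A B"
  shows "bij_betw (map_permutation A f) {p. p permutes A} {p. p permutes B}"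
proof (rule bij_betw_byWitness[where f' = "map_permutation B (inv_into A f)"])
  show "\<forall>p\<in>{p. p permutes A}. map_permutation B (inv_into A f) (map_permutation A f p) = p"
    using assms by (auto intro: map_permutation_compose_inv simp: bij_betw_inv_into_left)
  show "\<forall>p\<in>{p. p permutes B}. map_permutation A f (map_permutation B (inv_into A f) p) = p"
    using assms by (auto intro: map_permutation_compose_inv bij_betw_inv_into
        simp: bij_betw_inv_into_right)
  show "map_permutation A f ` {p. p permutes A} \<subseteq> {p. p permutes B}"
    using assms by (auto intro: map_permutation_permutes)
  show "map_permutation B (inv_into A f) ` {p. p permutes B} \<subseteq> {p. p permutes A}"
    using assms by (auto intro: map_permutation_permutes bij_betw_inv_into)
qed

text \<open>Distinct first indices identify the positions with the set of first indices;
  transporting permutations along this bijection preserves signs.\<close>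

lemma kdelta_distinct:
  assumes "distinct (map fst w)"
  shows "kdelta w = (\<Sum>p | p permutes fst ` set w. if \<forall>u\<in>set w. p (fst u)
      = snd u then of_int (sign p) else 0)"
proof -
  let ?I = "{..<length w}" and ?f = "\<lambda>a. fst (w ! a)"
  have bij: "bij_betw ?f ?I (fst ` set w)"
    using bij_betw_nth[OF assms, of ?I "fst ` set w"] 
    by (subst bij_betw_cong[where g = "(!) (map fst w)"]) auto
  then have inj: "inj_on ?f ?I" by (rule bij_betw_imp_inj_on)
  have "(\<Sum>p | p permutes fst ` set w. if \<forall>u\<in>set w. p (fst u) = snd u then of_int (sign p) else 0)
     = (\<Sum>\<pi> | \<pi> permutes ?I. if \<forall>u\<in>set w. map_permutation ?I ?f \<pi> (fst u) = snd u
          then of_int (sign (map_permutation ?I ?f \<pi>)) else 0 :: complex)"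
    by (rule sum.reindex_bij_betw[OF bij_betw_map_permutation[OF bij], symmetric])
  also have "\<dots> = kdelta w"
    unfolding kdelta_def kronecker_def
  proof (intro sum.cong refl)
    fix \<pi> assume p: "\<pi> \<in> {\<pi>. \<pi> permutes ?I}"
    have "(\<Prod>a<length w. of_bool (fst (w ! \<pi> a) = snd (w ! a)))
        = (of_bool (\<forall>a<length w. fst (w ! \<pi> a) = snd (w ! a)) :: complex)"
      by (auto intro!: prod.neutral)
    moreover have "map_permutation ?I ?f \<pi> (fst (w ! a)) = fst (w ! \<pi> a)" if "a < length w" for a
      using map_permutation_apply[OF inj, of a] that by simp
    ultimately show "(if \<forall>u\<in>set w. map_permutation ?I ?f \<pi> (fst u) = snd u
          then of_int (sign (map_permutation ?I ?f \<pi>)) else 0 :: complex)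
       = of_int (sign \<pi>) * (\<Prod>a<length w. of_bool (fst (w ! \<pi> a) = snd (w ! a)))"
      using p by (auto simp: sign_map_permutation[OF inj] all_set_conv_all_nth)
  qed
  finally show ?thesis by simp
qed

text \<open>Both sides vanish if a first index repeats. Otherwise only the minor on the set of first
  indices of \<open>w\<close> contributes.\<close>

lemma symmetrise_Delta:
  assumes "k \<le> CARD('n)"
  shows "symmetrise (Delta k :: 'n::finite sym_gl) w = (if length w = k then kdelta w / fact k else 0)"
proof -
  have sum: "symmetrise (Delta k) w = (\<Sum>S | card S = k. \<Sum>p | p permutes S.
      if distinct (map fst w) \<and> fst ` set w = S \<and> (\<forall>u\<in>set w. p (fst u) = snd u)
       then of_int (sign p) / fact (card S) else 0)"
    by (simp add: Delta_eq_sum_minors[OF assms] symmetrise_sum symmetrise_minor)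
  show ?thesis
  proof (cases "distinct (map fst w)")
    case False
    then have "\<not> inj_on (\<lambda>a. fst (w ! a)) {..<length w}"
      by (auto simp: inj_on_def distinct_conv_nth)
    then have "kdelta w = 0" by (simp add: kdelta_def kronecker_eq_0)
    moreover have "symmetrise (Delta k) w = 0"
      unfolding sum using False by simp
    ultimately show ?thesis by simp
  next
    case True
    let ?T = "fst ` set w"
    have card: "card ?T = length w" using distinct_card[OF True] by simp
    have "symmetrise (Delta k) w = (\<Sum>S | card S = k. if S = ?T then
        (\<Sum>p | p permutes ?T. if \<forall>u\<in>set w. p (fst u)
            = snd u then of_int (sign p) else 0) / fact k else 0)"
      unfolding sum
    proof (intro sum.cong refl)
      fix S :: "'n set" assume S: "S \<in> {S. card S = k}"
      show "(\<Sum>p | p permutes S. if distinct (map fst w) \<and> ?T = S \<and> (\<forall>u\<in>set w. p (fst u) = snd u)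
          then of_int (sign p) / fact (card S) else 0)
        = (if S = ?T then (\<Sum>p | p permutes ?T. if \<forall>u\<in>set w. p (fst u) = snd u
          then of_int (sign p) else 0) / fact k else 0 :: complex)"
      proof (cases "S = ?T")
        case True
        then show ?thesis
          using \<open>distinct (map fst w)\<close> S by (auto simp: sum_divide_distrib intro!: sum.cong)
      next
        case False
        then show ?thesis by (simp add: eq_commute[of "fst ` set w" S])
      qed
    qed
    also have "\<dots> = (if length w = k then kdelta w / fact k else 0)"
      using card by (simp add: kdelta_distinct[OF True])
    finally show ?thesis .
  qed
qed

section \<open>Adjoint factors applied to the symmetrised \<open>Delta k\<close>\<close>

lemma ad_tensor_Delta:
  assumes "k \<le> CARD('n)"
  shows "ad_tensor m (symmetrise (Delta k :: 'n::finite sym_gl)) w X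
    = (if m + length w = k then msc (1 / fact k) (ad_tensor m kdelta w X) else 0)"
  by (auto simp: ad_tensor_def symmetrise_Delta[OF assms] msc_sum msc_simps
      intro!: sum.cong sum.neutral)

text \<open>For the only relevant word length, the product in \<open>ad_tensor_kdelta_odd\<close> is
  the falling factorial of \<open>n - k + 2 * r\<close> of length \<open>2 * r\<close>. The other
  factorials come from the two symmetrisations.\<close>

lemma ad_tensor_Delta_odd:
  fixes X :: "'n::finite gl"
  assumes k: "k \<le> CARD('n)" "2 * r + 1 \<le> k"
  shows "ad_tensor (2 * r + 1) (symmetrise (Delta k)) w X
    = msc (fact (2 * r) * fact (k - 2 * r) / fact k * of_nat ((CARD('n) - k + 2 * r) choose (2 * r)))
        (ad_tensor 1 (symmetrise (Delta (k - 2 * r))) w X)"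
proof (cases "length w = k - 2 * r - 1")
  case False
  then have "2 * r + 1 + length w \<noteq> k" "1 + length w \<noteq> k - 2 * r" using k by linarith+
  then show ?thesis using k by (simp add: ad_tensor_Delta msc_simps)
next
  case True
  let ?N = "CARD('n) - k + 2 * r"
  have "of_nat CARD('n) - of_nat (length w) - 1 = (of_nat ?N :: complex)"
    using k True by (simp add: of_nat_diff)
  then have "(\<Prod>a<2 * r. of_nat CARD('n) - of_nat (length w) - 1 - of_nat a :: complex)
      = (\<Prod>a<2 * r. of_nat ?N - of_nat a)" by (simp only:)
  also have "\<dots> = fact (2 * r) * of_nat (?N choose (2 * r))"
    unfolding binomial_gbinomial gbinomial_mult_fact by (simp add: atLeast0LessThan)
  finally have "ad_tensor (2 * r + 1) kdelta w X
      = msc (fact (2 * r) * of_nat (?N choose (2 * r))) (ad_tensor 1 kdelta w X)"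
    unfolding ad_tensor_kdelta_odd ad_tensor_kdelta_1 by (simp only:)
  moreover have "2 * r + 1 + length w = k" "1 + length w = k - 2 * r" using k True by linarith+
  ultimately show ?thesis
    using k by (simp add: ad_tensor_Delta msc_simps)
qed

lemma kdelta_single: "kdelta [(i, j)] = of_bool (i = j)"
  by (simp add: kdelta_def kronecker_def lessThan_Suc)

text \<open>\<open>Delta 1\<close> is the trace form, which corresponds to the identity matrix, and
  that is central.\<close>

lemma ad_tensor_Delta_1: "ad_tensor 1 (symmetrise (Delta 1)) w X = (0 :: 'n::finite gl)"
proof (cases w)
  case Nil
  have "left_term X [] = X" "right_term X [] = X"
    by (simp_all add: left_term_def right_term_def kdelta_single vec_eq_iff of_bool_def
        if_distrib if_distribR cong: if_cong)
  then show ?thesis using Nil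
    by (simp add: ad_tensor_Delta ad_tensor_kdelta_1[unfolded One_nat_def] msc_simps)
next
  case Cons
  then show ?thesis using ad_tensor_Delta[of 1 1 w X] by simp
qed

section \<open>Restriction to the special linear algebra\<close>

text \<open>The kernel \<open>pure (map (sl_part \<circ> munit) v) w\<close> is the matrix of the
  tensor power of the projection to \<open>sl\<close>.\<close>

lemma pure_map_sl_part:
  "length w = length ys \<Longrightarrow> pure (map sl_part ys) w
    = (\<Sum>v | length v = length ys. pure ys v * pure (map (sl_part \<circ> munit) v) w)"
proof (induction ys arbitrary: w)
  case Nil
  then show ?case by (simp add: pure_def)
next
  case (Cons y ys)
  then obtain u w' where w: "w = u # w'" "length w' = length ys" by (cases w) auto
  have "sl_part y = (\<Sum>x\<in>UNIV. msc (y $ fst x $ snd x) (sl_part (munit x)))"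
    using arg_cong[OF gl_decomp, of sl_part y] by (simp add: sl_part_sum sl_part_msc)
  then have "sl_part y $ fst u $ snd u
      = (\<Sum>x\<in>UNIV. y $ fst x $ snd x * sl_part (munit x) $ fst u $ snd u)"
    by (simp add: msc_def)
  then show ?case
    using w by (simp add: pure_Cons sum_lists_Suc Cons.IH sum_product algebra_simps)
qed

lemma sym_pure_map_sl_part:
  "sym_pure (map sl_part ys) w
    = (\<Sum>v | length v = length w. sym_pure ys v * pure (map (sl_part \<circ> munit) v) w)"
proof (cases "length w = length ys")
  case True
  then show ?thesis
    by (simp add: sym_pure_def permute_list_map pure_map_sl_part sum_distrib_left sum_distrib_right
        mult.assoc)
       (rule sum.swap)
next
  case False
  then show ?thesis
    by (auto simp: sym_pure_def pure_def intro!: sum.neutral)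
qed

lemma symmetrise_const_mult: "symmetrise (const c * H) w = c * symmetrise H w"
proof (induction H rule: sym_gl_induct)
  case (single M d)
  obtain us where "M = mset us" by (metis ex_mset)
  then show ?case by (simp add: const_mult symmetrise_single)
qed (simp add: symmetrise_add algebra_simps)

lemma symmetrise_sl_subst:
  "symmetrise (sl_subst H) w
    = (\<Sum>v | length v = length w. symmetrise H v * pure (map (sl_part \<circ> munit) v) w)"
proof (induction H rule: sym_gl_induct)
  case (single M c)
  obtain us where us: "M = mset us" by (metis ex_mset)
  have "sl_subst (Poly_Mapping.single M c) = const c * prod_list (map lin (map sl_part (map munit us)))"
    by (simp add: sl_subst_single us o_def flip: prod_mset_prod_list mset_map)
  then show ?case
    by (simp only: symmetrise_const_mult symmetrise_prod_lin sym_pure_map_sl_part symmetrise_single us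
        sum_distrib_left mult.assoc)
qed (simp add: sl_subst_add symmetrise_add sum.distrib algebra_simps)

text \<open>The projection changes \<open>y\<close> by a scalar matrix, which commutes with
  \<open>X\<close>.\<close>

lemma ad_sl_part: "ad (sl_part y) X = ad y X"
proof -
  have "ad (msc c (mat 1)) X = 0" for c
    by (simp add: ad_msc) (simp add: ad_def msc_simps)
  then show ?thesis
    using ad_add[of "sl_part y" "msc (trace y / of_nat CARD('a)) (mat 1)" X]
    by (simp add: sl_part_def)
qed

lemma pure_append:
  "length v = length ys \<Longrightarrow> pure (ys @ zs) (v @ w) = pure ys v * pure zs w"
  by (induction v ys rule: list_induct2) (simp_all add: pure_Cons mult.assoc, simp add: pure_def)

lemma msc_sum_left: "msc (\<Sum>i\<in>I. f i) A = (\<Sum>i\<in>I. msc (f i) A)"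
  by (induction I rule: infinite_finite_induct) (simp_all add: msc_simps)

lemma sum_lists_append:
  fixes f :: "'a::finite list \<Rightarrow> 'b::comm_monoid_add"
  shows "(\<Sum>v | length v = m + l. f v) = (\<Sum>v | length v = m. \<Sum>w | length w = l. f (v @ w))"
  by (induction m arbitrary: f) (simp_all add: sum_lists_Suc)

text \<open>The projection kernel splits into a part on the adjoint letters, absorbed by
  \<open>ad_sl_part\<close>, and a part on the remaining letters. The latter does not depend on how
  many adjoint factors there are.\<close>

lemma ad_tensor_sl_subst:
  "ad_tensor m (symmetrise (sl_subst H)) w X
    = (\<Sum>v | length v = length w. msc (pure (map (sl_part \<circ> munit) v) w)
        (ad_tensor m (symmetrise H) v X))"
proof -
  let ?K = "\<lambda>v. pure (map (sl_part \<circ> munit) v)"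
  let ?L = "{v :: ('a \<times> 'a) list. length v = m}" and ?L' = "{v :: ('a \<times> 'a) list. length v = length w}"
  have ad: "(\<Sum>x\<in>?L. msc (?K v x) (ad_prod (map munit x) X)) = ad_prod (map munit v) X"
    if v: "v \<in> ?L" for v
  proof -
    have "(\<Sum>x\<in>?L. msc (?K v x) (ad_prod (map munit x) X)) = ad_tensor m (?K v) [] X"
      by (simp add: ad_tensor_def)
    also have "\<dots> = ad_prod (map (sl_part \<circ> munit) v) X"
      using ad_tensor_pure[of "map (sl_part \<circ> munit) v" "[]" "[]" X] v by (simp add: pure_def msc_simps)
    also have "\<dots> = ad_prod (map munit v) X"
      by (induction v) (simp_all add: ad_prod_simps ad_sl_part)
    finally show ?thesis .
  qed
  have "ad_tensor m (symmetrise (sl_subst H)) w X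
      = (\<Sum>x\<in>?L. \<Sum>v\<in>?L. \<Sum>v'\<in>?L'. msc (symmetrise H (v @ v')
          * (?K v x * ?K v' w)) (ad_prod (map munit x) X))"
    unfolding ad_tensor_def
    by (intro sum.cong refl)
       (simp add: symmetrise_sl_subst sum_lists_append pure_append msc_sum_left)
  also have "\<dots> = (\<Sum>v\<in>?L. \<Sum>v'\<in>?L'. \<Sum>x\<in>?L. msc (symmetrise H (v @ v')
      * (?K v x * ?K v' w)) (ad_prod (map munit x) X))"
    by (rule sum_rotate)
  also have "\<dots> = (\<Sum>v\<in>?L. \<Sum>v'\<in>?L'. msc (symmetrise H (v @ v') * ?K v' w) (ad_prod (map munit v) X))"
  proof (intro sum.cong refl)
    fix v v' assume v: "v \<in> ?L"
    have "(\<Sum>x\<in>?L. msc (symmetrise H (v @ v') * (?K v x * ?K v' w)) (ad_prod (map munit x) X))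
        = msc (symmetrise H (v @ v') * ?K v' w) (\<Sum>x\<in>?L. msc (?K v x) (ad_prod (map munit x) X))"
      by (simp add: msc_sum msc_simps mult.assoc mult.commute mult.left_commute)
    then show "(\<Sum>x\<in>?L. msc (symmetrise H (v @ v') * (?K v x * ?K v' w)) (ad_prod (map munit x) X))
        = msc (symmetrise H (v @ v') * ?K v' w) (ad_prod (map munit v) X)"
      by (simp only: ad[OF v])
  qed
  also have "\<dots> = (\<Sum>v'\<in>?L'. msc (?K v' w) (ad_tensor m (symmetrise H) v' X))"
    by (subst sum.swap) (simp add: ad_tensor_def msc_sum msc_simps mult.commute)
  finally show ?thesis .
qed

section \<open>The formulas for \<open>m_map\<close> on both Lie algebras\<close>

lemma sl_restriction_eq_sl_subst: "sl_restriction H = sl_subst H"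
  unfolding sl_restriction_def
  by (intro the_equality conjI sl_subst_in_sym_sl sl_subst_cong) (use sl_restriction_unique in blast)

text \<open>Embedding the first tensor factor via \<open>ad\<close> amounts to a single adjoint
  factor, so both sides of the formula are values of \<open>m_map\<close>.\<close>

lemma ad_embed_eq_m_map: "ad_embed g H = m_map g 1 H"
proof -
  have "ad_tensor 1 t = (\<lambda>w X. \<Sum>u\<in>UNIV. msc (t (u # w)) (ad (munit u) X))" for t :: "'a::finite tensor"
    unfolding One_nat_def by (simp only: fun_eq_iff ad_tensor_def sum_lists_Suc)
        (simp add: ad_prod_simps)
  then show ?thesis by (simp only: ad_embed_def m_map_def)
qed

text \<open>The constant is the same for all words, so it passes through the projection kernel and
  the second claim follows from the identity on \<open>gl\<close>.\<close>

lemma m_map_Delta: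
  assumes k: "k \<le> CARD('n)" "2 * r + 1 \<le> k"
  defines "c \<equiv> fact (2 * r) * fact (k - 2 * r) / fact k * of_nat ((CARD('n) - k + 2 * r) choose (2 * r))"
  shows "m_map g (2 * r + 1) (Delta k :: 'n::finite sym_gl)
      = scale_end c (m_map g 1 (Delta (k - 2 * r)))"
    and "m_map g (2 * r + 1) (Delta_sl k :: 'n::finite sym_gl)
        = scale_end c (m_map g 1 (Delta_sl (k - 2 * r)))"
proof -
  note odd = ad_tensor_Delta_odd[OF k, folded c_def]
  show "m_map g (2 * r + 1) (Delta k :: 'n::finite sym_gl)
      = scale_end c (m_map g 1 (Delta (k - 2 * r)))"
    unfolding m_map_def scale_end_def restrict_to_def odd by (simp add: fun_eq_iff msc_simps)
  show "m_map g (2 * r + 1) (Delta_sl k :: 'n::finite sym_gl)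
      = scale_end c (m_map g 1 (Delta_sl (k - 2 * r)))"
    unfolding m_map_def scale_end_def restrict_to_def Delta_sl_def sl_restriction_eq_sl_subst
      ad_tensor_sl_subst odd
    by (simp add: fun_eq_iff msc_simps msc_sum mult.commute)
qed

lemma m_map_Delta_1:
  "m_map g 1 (Delta 1 :: 'n::finite sym_gl) = (\<lambda>w X. 0)"
  "m_map g 1 (Delta_sl 1 :: 'n::finite sym_gl) = (\<lambda>w X. 0)"
  unfolding m_map_def restrict_to_def Delta_sl_def sl_restriction_eq_sl_subst
      ad_tensor_sl_subst ad_tensor_Delta_1
  by (simp_all add: fun_eq_iff msc_simps)

text \<open>For \<open>r = 1\<close> the formula leads to \<open>Delta 1\<close>, which one adjoint
  factor kills; if the matrices have size below 3, \<open>Delta 3\<close> is 0 by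
  definition.\<close>

lemma m_map_Delta_3:
  "m_map g 3 (Delta 3 :: 'n::finite sym_gl) = (\<lambda>w X. 0)"
  "m_map g 3 (Delta_sl 3 :: 'n::finite sym_gl) = (\<lambda>w X. 0)"
proof -
  have "m_map g 3 (Delta 3 :: 'n sym_gl) = (\<lambda>w X. 0) \<and> m_map g 3 (Delta_sl 3 :: 'n sym_gl) = (\<lambda>w X. 0)"
  proof (cases "3 \<le> CARD('n)")
    case True
    then show ?thesis
      using m_map_Delta[where 'n = 'n and k = 3 and r = 1 and g = g]
      by (simp add: m_map_Delta_1[unfolded One_nat_def] scale_end_def msc_simps)
  next
    case False
    then show ?thesis
      by (simp add: Delta_def Delta_sl_def sl_restriction_eq_sl_subst sl_subst_zero m_map_def
          restrict_to_def ad_tensor_def symmetrise_zero msc_simps fun_eq_iff)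
  qed
  then show "m_map g 3 (Delta 3 :: 'n sym_gl) = (\<lambda>w X. 0)" "m_map g 3 (Delta_sl 3 :: 'n sym_gl)
      = (\<lambda>w X. 0)"
    by simp_all
qed

theorem proposition2p3:
  fixes n :: nat
  assumes "n = CARD('n::finite)" and "n \<ge> 2"
  shows "(\<forall>k r. k \<le> n \<and> k - 2 * r > 1 \<longrightarrow>
            m_map sl (2 * r + 1) (Delta_sl k :: 'n sym_gl) =
              scale_end (fact (2 * r) * fact (k - 2 * r) / fact k
                          * of_nat ((n - k + 2 * r) choose (2 * r)))
                (ad_embed sl (Delta_sl (k - 2 * r)))) \<and>
         m_map sl 3 (Delta_sl 3 :: 'n sym_gl) = (\<lambda>w X. 0) \<and>
         m_map gl 3 (Delta 3 :: 'n sym_gl) = (\<lambda>w X. 0)"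
proof (intro conjI allI impI)
  fix k r assume "k \<le> n \<and> k - 2 * r > 1"
  \<comment> \<open>A truncated difference above 1 has not been truncated, which gives the bound on
    \<open>r\<close>.\<close>
  then have "k \<le> CARD('n)" "2 * r + 1 \<le> k" using assms(1) by linarith+
  then show "m_map sl (2 * r + 1) (Delta_sl k :: 'n sym_gl) =
              scale_end (fact (2 * r) * fact (k - 2 * r) / fact k
                          * of_nat ((n - k + 2 * r) choose (2 * r)))
                (ad_embed sl (Delta_sl (k - 2 * r)))"
    unfolding ad_embed_eq_m_map assms(1) by (rule m_map_Delta(2))
qed (rule m_map_Delta_3)+

end
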